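(* For all $n\in\mathbb{Z}^+$, $C(\mathbb{Z},n)=1$.
   Context: $\mathbb{Z}$ carries its usual absolute value. A $\mathbb{Z}$-lattice in $\mathbb{Q}^n$ is a finitely generated subgroup $\Lambda\subset\mathbb{Q}^n$ spanning $\mathbb{Q}^n$ over $\mathbb{Q}$; its covolume is $\operatorname{Covol}\Lambda=a^{-n}[\mathbb{Z}^n:a\Lambda]$ for any positive integer $a$ with $a\Lambda\subset\mathbb{Z}^n$. The linear constant $C(\mathbb{Z},n)$ is the supremum of all real $C>0$ such that: for all $M=(m_{ij})\in GL_n(\mathbb{Q})$, all $\mathbb{Z}$-lattices $\Lambda\subset\mathbb{Q}^n$ and all real $\epsilon_1,\ldots,\epsilon_n>0$ with $|\det M|\operatorname{Covol}\Lambda\le C\prod_{i=1}^n\epsilon_i$, there is a nonzero $x=(x_1,\ldots,x_n)\in\Lambda$ with $|\sum_{j=1}^nm_{ij}x_j|\le\epsilon_i$ for all $1\le i\le n$. *)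

theory Defs
  imports "HOL-Analysis.Analysis" "HOL-Computational_Algebra.Group_Closure"
begin

definition rat_lattice :: "(rat ^ 'n) set \<Rightarrow> bool" where
  "rat_lattice \<Lambda> \<longleftrightarrow>
     (\<exists>B. finite B \<and> \<Lambda> = group_closure B) \<and> vec.span \<Lambda> = UNIV"

definition int_vectors :: "(rat ^ 'n) set" where
  "int_vectors = {x. \<forall>i. x $ i \<in> \<int>}"

text \<open>The number of cosets of \<open>H\<close> in \<open>G\<close>. By the convention for \<open>card\<close> it is 0 if there
  are infinitely many, but a lattice contained in \<open>int_vectors\<close> has finite index there.\<close>

definition add_index :: "'a::ab_group_add set \<Rightarrow> 'a set \<Rightarrow> nat" where
  "add_index G H = card ((\<lambda>g. (+) g ` H) ` G)"

definition clears_denominators :: "nat \<Rightarrow> (rat ^ 'n) set \<Rightarrow> bool" where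
  "clears_denominators a \<Lambda> \<longleftrightarrow> a > 0 \<and> (\<lambda>x. of_nat a *s x) ` \<Lambda> \<subseteq> int_vectors"

text \<open>For a lattice such an \<open>a\<close> exists and the value does not depend on its choice.\<close>

definition covol :: "(rat ^ 'n::finite) set \<Rightarrow> real" where
  "covol \<Lambda> = (let a = SOME a. clears_denominators a \<Lambda>
     in real (add_index int_vectors ((\<lambda>x. of_nat a *s x) ` \<Lambda>)) / real a ^ CARD('n))"

definition linear_admissible :: "'n::finite itself \<Rightarrow> real \<Rightarrow> bool" where
  "linear_admissible (_ :: 'n itself) C \<longleftrightarrow>
     (\<forall>(M :: rat ^ 'n ^ 'n) (\<Lambda> :: (rat ^ 'n) set) (\<epsilon> :: 'n \<Rightarrow> real).
        invertible M \<longrightarrow> rat_lattice \<Lambda> \<longrightarrow> (\<forall>i. \<epsilon> i > 0) \<longrightarrow>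
        real_of_rat \<bar>det M\<bar> * covol \<Lambda> \<le> C * (\<Prod>i\<in>UNIV. \<epsilon> i) \<longrightarrow>
        (\<exists>x\<in>\<Lambda>. x \<noteq> 0 \<and> (\<forall>i. real_of_rat \<bar>\<Sum>j\<in>UNIV. M $ i $ j * x $ j\<bar> \<le> \<epsilon> i)))"

text \<open>The constant \<open>C(\<int>, n)\<close> for \<open>n = CARD('n)\<close>. The supremum is taken in the extended reals,
  since on \<open>real\<close> the supremum of an empty or unbounded set is an unspecified number.\<close>

definition linear_constant :: "'n::finite itself \<Rightarrow> ereal" where
  "linear_constant T = Sup (ereal ` {C. C > 0 \<and> linear_admissible T C})"

end

theory Submission
  imports Defs
begin

text \<open>
  The lower bound \<open>C(\<int>, n) \<ge> 1\<close> is a pigeonhole argument with cosets. Let \<open>L = M \<Lambda>\<close>. Its covolume is \<open>\<bar>det M\<bar> Covol \<Lambda>\<close> (lemma \<open>has_covol_matrix\<close>), so for a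
  suitable \<open>k\<close> the group \<open>k L\<close> consists of integral vectors and has index at most
  \<open>\<Prod>i. k \<epsilon>\<^sub>i\<close> in \<open>\<int>\<^sup>n\<close>. The box of integral points with \<open>0 \<le> y\<^sub>i \<le> \<lfloor>k \<epsilon>\<^sub>i\<rfloor>\<close> has
  \<open>\<Prod>i. (\<lfloor>k \<epsilon>\<^sub>i\<rfloor> + 1) > \<Prod>i. k \<epsilon>\<^sub>i\<close> elements, hence two of them lie in the same coset of \<open>k L\<close>. Their
  difference is a nonzero element of \<open>k L\<close> whose coordinates are at most \<open>k \<epsilon>\<^sub>i\<close> in absolute value;
  dividing by \<open>k\<close> and applying \<open>M\<inverse>\<close> gives the point of \<open>\<Lambda>\<close> (lemma \<open>subgroup_point_in_box\<close>).

  The upper bound comes from \<open>\<Lambda> = \<int>\<^sup>n\<close> and \<open>M = 1\<close>: if \<open>C > 1\<close>, then taking all \<open>\<epsilon>\<^sub>i\<close> equal to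
  the \<open>n\<close>-th root of \<open>1 / C\<close>, which is less than 1, satisfies the volume condition, yet only \<open>0\<close> lies
  in the box.

  What takes work is the behaviour of the covolume under a rational matrix. Both sides are
  multiplicative in the matrix, so by Gaussian elimination it suffices to treat diagonal matrices,
  where the cosets can be listed, and integral shears, which permute \<open>\<int>\<^sup>n\<close>.
\<close>

section \<open>Cosets and index in an abelian group\<close>

definition add_subgroup :: "'a::ab_group_add set \<Rightarrow> bool" where
  "add_subgroup H \<longleftrightarrow> 0 \<in> H \<and> (\<forall>x\<in>H. \<forall>y\<in>H. x - y \<in> H)"

lemma add_subgroup_zero: "add_subgroup H \<Longrightarrow> 0 \<in> H"
  by (simp add: add_subgroup_def)

lemma add_subgroup_diff: "add_subgroup H \<Longrightarrow> x \<in> H \<Longrightarrow> y \<in> H \<Longrightarrow> x - y \<in> H"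
  by (simp add: add_subgroup_def)

lemma add_subgroup_add:
  assumes "add_subgroup H" "x \<in> H" "y \<in> H"
  shows "x + y \<in> H"
proof -
  have "x - (0 - y) \<in> H"
    using assms by (intro add_subgroup_diff add_subgroup_zero)
  then show ?thesis by simp
qed

lemma add_subgroup_group_closure: "add_subgroup (group_closure B)"
  by (simp add: add_subgroup_def group_closure.diff)

lemma add_subgroup_image:
  assumes "Modules.additive f" "add_subgroup H"
  shows "add_subgroup (f ` H)"
proof -
  interpret Modules.additive f by fact
  show ?thesis
    using assms(2) unfolding add_subgroup_def by (auto simp: zero[symmetric] diff[symmetric])
qed

lemma coset_eq_iff:
  assumes "add_subgroup H"
  shows "(+) g ` H = (+) h ` H \<longleftrightarrow> g - h \<in> H"
proof
  assume "(+) g ` H = (+) h ` H"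
  moreover have "g + 0 \<in> (+) g ` H"
    using add_subgroup_zero[OF assms] by blast
  ultimately obtain y where "y \<in> H" "g = h + y" by auto
  then show "g - h \<in> H" by simp
next
  assume d: "g - h \<in> H"
  have "(+) a ` H \<subseteq> (+) b ` H" if "a - b \<in> H" for a b
  proof
    fix x assume "x \<in> (+) a ` H"
    then obtain y where y: "y \<in> H" "x = b + ((a - b) + y)" by (auto simp: algebra_simps)
    then show "x \<in> (+) b ` H" using add_subgroup_add[OF assms that] by blast
  qed
  moreover have "h - g \<in> H"
    using add_subgroup_diff[OF assms add_subgroup_zero[OF assms] d] by simp
  ultimately show "(+) g ` H = (+) h ` H" using d by blast
qed

text \<open>
  After a representative of each coset of \<open>H\<close> is chosen, translating the cosets of \<open>K\<close> in \<open>H\<close> by it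
  produces every coset of \<open>K\<close> in \<open>G\<close> exactly once. Since \<open>card\<close> is 0 on infinite sets and
  \<open>card (A \<times> B) = card A * card B\<close> holds for all sets, the formula covers infinite indices too;
  it follows that a positive index of \<open>K\<close> in \<open>G\<close> forces a positive, that is finite, index of \<open>H\<close>.
\<close>

lemma add_index_mult:
  assumes G: "add_subgroup G" and H: "add_subgroup H" and K: "add_subgroup K"
    and "H \<subseteq> G" "K \<subseteq> H"
  shows "add_index G K = add_index G H * add_index H K"
proof -
  define co where "co = (\<lambda>(A::'a set) g. (+) g ` A)"
  have co_eq: "co A g = co A h \<longleftrightarrow> g - h \<in> A" if "add_subgroup A" for A g h
    using coset_eq_iff[OF that] by (simp add: co_def)
  define r where "r = (\<lambda>C. SOME g. g \<in> G \<and> co H g = C)"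
  have r: "r C \<in> G \<and> co H (r C) = C" if "C \<in> co H ` G" for C
    unfolding r_def by (rule someI_ex) (use that in auto)
  have shift: "(+) a ` co K h = co K (a + h)" for a h
    by (simp add: co_def image_image add.assoc)
  have "bij_betw (\<lambda>(C, D). (+) (r C) ` D) (co H ` G \<times> co K ` H) (co K ` G)"
    unfolding bij_betw_def
  proof
    show "inj_on (\<lambda>(C, D). (+) (r C) ` D) (co H ` G \<times> co K ` H)"
    proof (rule inj_onI, clarify)
      fix g g' h h'
      assume gh: "g \<in> G" "g' \<in> G" "h \<in> H" "h' \<in> H"
        and eq: "(+) (r (co H g)) ` co K h = (+) (r (co H g')) ` co K h'"
      let ?a = "r (co H g)" and ?b = "r (co H g')"
      have ab: "co H ?a = co H g" "co H ?b = co H g'"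
        using r gh by auto
      have "(?a + h) - (?b + h') \<in> K"
        using eq by (simp add: shift co_eq K)
      then have "(?a + h) - (?b + h') \<in> H" using \<open>K \<subseteq> H\<close> by blast
      then have "((?a + h) - (?b + h')) - (h - h') \<in> H"
        using gh H by (metis add_subgroup_diff)
      then have C: "co H g = co H g'"
        using ab co_eq[OF H, of ?a ?b] by (simp add: algebra_simps)
      moreover have "co K h = co K h'"
        using eq C by (simp add: inj_image_eq_iff)
      ultimately show "co H g = co H g' \<and> co K h = co K h'" by simp
    qed
  next
    show "(\<lambda>(C, D). (+) (r C) ` D) ` (co H ` G \<times> co K ` H) = co K ` G"
    proof (intro equalityI subsetI)
      fix E assume "E \<in> (\<lambda>(C, D). (+) (r C) ` D) ` (co H ` G \<times> co K ` H)"
      then obtain g h where gh: "g \<in> G" "h \<in> H" "E = co K (r (co H g) + h)"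
        by (auto simp: shift)
      moreover have "r (co H g) + h \<in> G"
        using r gh \<open>H \<subseteq> G\<close> by (intro add_subgroup_add[OF G]) auto
      ultimately show "E \<in> co K ` G" by blast
    next
      fix E assume "E \<in> co K ` G"
      then obtain g where g: "g \<in> G" "E = co K g" by blast
      let ?a = "r (co H g)"
      have "g - ?a \<in> H"
        using r[of "co H g"] g co_eq[OF H, of g ?a] by auto
      moreover have "E = (+) ?a ` co K (g - ?a)"
        using g by (simp add: shift)
      ultimately show "E \<in> (\<lambda>(C, D). (+) (r C) ` D) ` (co H ` G \<times> co K ` H)"
        using g(1) by force
    qed
  qed
  then have "card (co H ` G \<times> co K ` H) = card (co K ` G)"
    by (rule bij_betw_same_card)
  then show ?thesis
    by (simp add: add_index_def co_def card_cartesian_product)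
qed

lemma add_index_image:
  assumes "Modules.additive f" "inj f"
  shows "add_index (f ` G) (f ` H) = add_index G H"
proof -
  interpret Modules.additive f by fact
  have "(\<lambda>g. (+) g ` f ` H) ` f ` G = (\<lambda>A. f ` A) ` (\<lambda>g. (+) g ` H) ` G"
    by (simp add: image_image add)
  moreover have "inj ((`) f)"
    using assms(2) by (simp add: inj_image_eq_iff inj_def)
  ultimately show ?thesis
    by (simp add: add_index_def card_image inj_on_subset)
qed

section \<open>Integral vectors and common denominators\<close>

definition int_vec :: "('n \<Rightarrow> int) \<Rightarrow> rat ^ 'n::finite" where
  "int_vec g = (\<chi> i. of_int (g i))"

lemma int_vec_nth [simp]: "int_vec g $ i = of_int (g i)"
  by (simp add: int_vec_def)

lemma int_vectors_eq_range: "int_vectors = range int_vec"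
proof (intro equalityI subsetI)
  fix x :: "rat ^ 'n" assume "x \<in> int_vectors"
  then have "\<forall>i. \<exists>z. x $ i = of_int z" by (auto simp: int_vectors_def Ints_def)
  then obtain g where "\<forall>i. x $ i = of_int (g i)" by metis
  then have "x = int_vec g" by (simp add: vec_eq_iff)
  then show "x \<in> range int_vec" by blast
qed (auto simp: int_vectors_def)

lemma add_subgroup_int_vectors: "add_subgroup int_vectors"
  by (simp add: add_subgroup_def int_vectors_def)

lemma common_denominator:
  fixes X :: "rat set"
  assumes "finite X"
  obtains q :: nat where "q > 0" "\<And>x. x \<in> X \<Longrightarrow> of_nat q * x \<in> \<int>"
proof -
  have "\<exists>q::nat. q > 0 \<and> (\<forall>x\<in>X. of_nat q * x \<in> \<int>)"
    using assms
  proof (induction X)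
    case (insert y X)
    then obtain q :: nat where q: "q > 0" "\<forall>x\<in>X. of_nat q * x \<in> \<int>" by blast
    obtain a b where ab: "y = of_int a / of_int b" "b > 0"
      by (metis Fract_of_int_quotient Rat_cases)
    have "of_nat (q * nat b) * x \<in> \<int>" if "x \<in> insert y X" for x
    proof (cases "x = y")
      case True
      then have "of_nat (q * nat b) * x = of_int (int q * a)" using ab by simp
      then show ?thesis by (metis Ints_of_int)
    next
      case False
      then have "of_nat q * x \<in> \<int>" using that q by blast
      then have "of_nat (nat b) * (of_nat q * x) \<in> \<int>"
        by (rule Ints_mult[OF Ints_of_nat])
      then show ?thesis by (simp add: mult_ac)
    qed
    then show ?case using q ab by (intro exI[of _ "q * nat b"]) auto
  qed auto
  then show thesis using that by blast
qed

section \<open>Diagonal matrices and column replacements\<close>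

definition diag_mat :: "('n \<Rightarrow> 'a::zero) \<Rightarrow> 'a ^ 'n ^ 'n" where
  "diag_mat d = (\<chi> i j. if i = j then d i else 0)"

definition col_mat :: "'n \<Rightarrow> 'a::zero_neq_one ^ 'n \<Rightarrow> 'a ^ 'n ^ 'n" where
  "col_mat s c = (\<chi> i j. if j = s then c $ i else mat 1 $ i $ j)"

lemma diag_mat_mult_vec: "(diag_mat d *v x) $ i = (d i::'a::comm_semiring_1) * x $ i"
  by (simp add: diag_mat_def matrix_vector_mult_def if_distrib[of "\<lambda>z. z * _"] cong: if_cong)

lemma det_diag_mat: "det (diag_mat d) = (\<Prod>i\<in>UNIV. (d i :: 'a::comm_ring_1))"
  by (subst det_diagonal) (auto simp: diag_mat_def)

lemma col_mat_mult_vec: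
  fixes c :: "'a::comm_ring_1 ^ 'n::finite"
  shows "(col_mat s c *v x) $ i = c $ i * x $ s + (if i = s then 0 else x $ i)"
proof -
  have "(col_mat s c *v x) $ i =
      (\<Sum>j\<in>UNIV. if j = s then c $ i * x $ s else if i = j then x $ j else 0)"
    unfolding col_mat_def matrix_vector_mult_def
    by (auto simp: mat_def intro!: sum.cong)
  also have "\<dots> = c $ i * x $ s + (\<Sum>j\<in>UNIV - {s}. if i = j then x $ j else 0)"
    by (subst sum.remove[of _ s]) (auto intro!: sum.cong)
  also have "\<dots> = c $ i * x $ s + (if i = s then 0 else x $ i)"
    by (simp add: sum.delta')
  finally show ?thesis .
qed

lemma det_col_mat:
  fixes c :: "'a::field ^ 'n::finite"
  shows "det (col_mat s c) = c $ s"
  using cramer_lemma[where A = "mat 1" and k = s and x = c]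
  unfolding col_mat_def matrix_vector_mul_lid by simp

lemma column_mult: "column j (A ** B) = A *v column j B"
  by (simp add: column_def matrix_matrix_mult_def matrix_vector_mult_def vec_eq_iff)

lemma col_mat_inverse:
  fixes c :: "'a::field ^ 'n::finite"
  assumes "c $ s \<noteq> 0"
  shows "col_mat s c ** col_mat s (\<chi> i. if i = s then 1 / c $ s else - c $ i / c $ s) = mat 1"
  using assms
  by (intro iffD2[OF matrix_eq])
     (simp add: vec_eq_iff matrix_vector_mul_assoc[symmetric] col_mat_mult_vec field_simps)

text \<open>
  Gaussian elimination as an induction principle. The induction is on the set \<open>T\<close> of columns that are
  not yet known to agree with the identity matrix. If the diagonal entry in column \<open>s\<close> is nonzero, a
  factor \<open>col_mat s c\<close>, where \<open>c\<close> is that column, can be split off on the left, and what remains has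
  \<open>s\<close> as a further identity column. Otherwise some row with index in \<open>T\<close> has a nonzero entry in
  column \<open>s\<close>, and adding it to row \<open>s\<close> creates the pivot; this is again multiplication by a \<open>col_mat\<close>.
\<close>

lemma nonsingular_induct:
  fixes P :: "'a::field ^ 'n ^ 'n::finite \<Rightarrow> bool"
  assumes mult: "\<And>A B. P A \<Longrightarrow> P B \<Longrightarrow> P (A ** B)"
    and one: "P (mat 1)"
    and col: "\<And>s c. c $ s \<noteq> 0 \<Longrightarrow> P (col_mat s c)"
    and "det A \<noteq> 0"
  shows "P A"
proof -
  have "\<forall>A. det A \<noteq> 0 \<longrightarrow> (\<forall>j. j \<notin> T \<longrightarrow> column j A = axis j 1) \<longrightarrow> P A" if "finite T" for T
    using that
  proof (induction T)
    case empty
    have "A = mat 1" if "\<forall>j. column j A = axis j 1" for A :: "'a ^ 'n ^ 'n"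
      using that by (auto simp: vec_eq_iff column_def axis_def mat_def)
    then show ?case using one by auto
  next
    case (insert s T)
    have pivot: "P A" if A: "det A \<noteq> 0" "\<And>j. j \<notin> insert s T \<Longrightarrow> column j A = axis j 1"
      and nz: "A $ s $ s \<noteq> 0" for A
    proof -
      define c where "c = column s A"
      define c' where "c' = (\<chi> i. if i = s then 1 / c $ s else - c $ i / c $ s)"
      have cs: "c $ s \<noteq> 0" using nz by (simp add: c_def column_def)
      have "column j (col_mat s c' ** A) = axis j 1" if "j \<notin> T" for j
      proof (cases "j = s")
        case True
        then show ?thesis using cs
          by (simp add: column_mult vec_eq_iff col_mat_mult_vec c_def[symmetric] c'_def axis_def)
      next
        case False
        then show ?thesis using A(2)[of j] that
          by (auto simp: column_mult vec_eq_iff col_mat_mult_vec axis_def)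
      qed
      moreover have "det (col_mat s c' ** A) \<noteq> 0"
        using A cs by (simp add: det_mul det_col_mat c'_def)
      ultimately have "P (col_mat s c' ** A)" using insert.IH by blast
      then have "P (col_mat s c ** (col_mat s c' ** A))" using mult col cs by blast
      then show ?thesis
        using col_mat_inverse[OF cs] by (simp add: matrix_mul_assoc c'_def)
    qed
    show ?case
    proof (intro allI impI)
      fix A :: "'a ^ 'n ^ 'n"
      assume det: "det A \<noteq> 0" and cols: "\<forall>j. j \<notin> insert s T \<longrightarrow> column j A = axis j 1"
      show "P A"
      proof (cases "A $ s $ s = 0")
        case False
        then show ?thesis using pivot det cols by blast
      next
        case True
        have "\<exists>i\<in>T. A $ i $ s \<noteq> 0"
        proof (rule ccontr)
          assume no: "\<not> ?thesis"
          \<comment> \<open>Column \<open>s\<close> is then a combination of the identity columns outside \<open>insert s T\<close>;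
            \<open>v\<close> lists the coefficients of this linear dependence.\<close>
          define v where "v = (\<chi> j. if j = s then 1 else if j \<in> T then 0 else - A $ j $ s)"
          have "(A *v v) $ i = 0" for i
          proof -
            define w where "w = (if i \<in> T then 0 else - A $ i $ s)"
            have "(A *v v) $ i = (\<Sum>j\<in>UNIV. if j = s then A $ i $ s else if j = i then w else 0)"
              unfolding matrix_vector_mult_def v_def w_def
              using cols by (auto intro!: sum.cong simp: column_def vec_eq_iff axis_def)
            also have "\<dots> = A $ i $ s + (\<Sum>j\<in>UNIV - {s}. if j = i then w else 0)"
              by (subst sum.remove[of _ s]) (auto intro!: sum.cong)
            also have "\<dots> = 0"
              using no True by (auto simp: sum.delta w_def)
            finally show ?thesis .
          qed
          then have "A *v v = 0" by (simp add: vec_eq_iff)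
          moreover have "v $ s \<noteq> 0" by (simp add: v_def)
          ultimately show False
            using det by (metis invertible_det_nz matrix_left_invertible_ker invertible_def zero_index)
        qed
        then obtain i where i: "i \<in> T" "A $ i $ s \<noteq> 0" by blast
        then have "i \<noteq> s" using insert.hyps by blast
        \<comment> \<open>Row \<open>i\<close> is added to row \<open>s\<close>. The identity columns survive because they vanish in row \<open>i\<close>.\<close>
        define B where "B = col_mat i (axis i 1 + axis s 1) ** A"
        have BA: "B $ k $ j = (if k = s then A $ s $ j + A $ i $ j else A $ k $ j)" for k j
        proof -
          have "B $ k $ j = column j B $ k" by (simp add: column_def)
          also have "\<dots> = (if k = s then A $ s $ j + A $ i $ j else A $ k $ j)"
            using \<open>i \<noteq> s\<close> unfolding B_def column_mult
            by (auto simp: col_mat_mult_vec axis_def column_def)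
          finally show ?thesis .
        qed
        have "det B \<noteq> 0"
          using det \<open>i \<noteq> s\<close> by (simp add: B_def det_mul det_col_mat axis_def)
        moreover have "column j B = axis j 1" if "j \<notin> insert s T" for j
        proof -
          have "column j A = axis j 1" "j \<noteq> i" using cols that i by auto
          then show ?thesis by (auto simp: column_def vec_eq_iff BA axis_def)
        qed
        moreover have "B $ s $ s \<noteq> 0" using True i by (simp add: BA)
        ultimately have "P B" by (intro pivot) auto
        moreover have "P (col_mat i (axis i 1 - axis s 1))"
          using \<open>i \<noteq> s\<close> by (intro col) (simp add: axis_def)
        ultimately have "P (col_mat i (axis i 1 - axis s 1) ** B)"
          by (intro mult)
        moreover have "col_mat i (axis i 1 - axis s 1) ** B = A"
        proof -
          have "column j (col_mat i (axis i 1 - axis s 1) ** B) $ k = A $ k $ j" for j k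
            using \<open>i \<noteq> s\<close> unfolding column_mult
            by (auto simp: col_mat_mult_vec axis_def column_def BA)
          then show ?thesis by (simp add: vec_eq_iff column_def)
        qed
        ultimately show "P A" by simp
      qed
    qed
  qed
  from this[of UNIV] show ?thesis using \<open>det A \<noteq> 0\<close> by simp
qed

section \<open>Covolumes under linear maps\<close>

lemma additive_matrix: "Modules.additive ((*v) (A :: 'a::comm_ring_1 ^ 'n ^ 'm))"
  by unfold_locales (simp add: matrix_vector_right_distrib)

lemma inj_diag_mat:
  fixes d :: "'n::finite \<Rightarrow> 'a::field"
  assumes "\<And>i. d i \<noteq> 0"
  shows "inj ((*v) (diag_mat d))"
proof (rule injI)
  fix x y assume "diag_mat d *v x = diag_mat d *v y"
  then have "d i * x $ i = d i * y $ i" for i by (metis diag_mat_mult_vec)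
  then show "x = y" using assms by (simp add: vec_eq_iff)
qed

lemma scale_eq_diag_mat: "k *s x = diag_mat (\<lambda>_. k) *v (x :: 'a::comm_ring_1 ^ 'n::finite)"
  by (simp add: vec_eq_iff diag_mat_mult_vec)

text \<open>
  The box \<open>\<Prod>i. {0..<\<bar>p i\<bar>}\<close> is a system of representatives of the cosets, by coordinatewise division
  with remainder.
\<close>

lemma add_index_diag_mat:
  fixes p :: "'n::finite \<Rightarrow> int"
  assumes p: "\<And>i. p i \<noteq> 0"
  shows "add_index int_vectors ((*v) (diag_mat (\<lambda>i. rat_of_int (p i))) ` int_vectors)
    = (\<Prod>i\<in>UNIV. nat \<bar>p i\<bar>)"
proof -
  let ?H = "(*v) (diag_mat (\<lambda>i. rat_of_int (p i))) ` int_vectors :: (rat ^ 'n) set"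
  let ?R = "PiE UNIV (\<lambda>i. {0..<\<bar>p i\<bar>})"
  have sub: "add_subgroup ?H"
    by (intro add_subgroup_image additive_matrix add_subgroup_int_vectors)
  have mem: "int_vec g - int_vec h \<in> ?H \<longleftrightarrow> (\<forall>i. p i dvd g i - h i)" for g h
  proof
    assume "int_vec g - int_vec h \<in> ?H"
    then obtain z where z: "int_vec g - int_vec h = diag_mat (\<lambda>i. rat_of_int (p i)) *v int_vec z"
      by (auto simp: int_vectors_eq_range)
    have "g i - h i = p i * z i" for i
    proof -
      have "rat_of_int (g i - h i) = (int_vec g - int_vec h) $ i" by simp
      also have "\<dots> = rat_of_int (p i * z i)" unfolding z by (simp add: diag_mat_mult_vec)
      finally show ?thesis by (simp only: of_int_eq_iff)
    qed
    then show "\<forall>i. p i dvd g i - h i" by simp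
  next
    assume dvd: "\<forall>i. p i dvd g i - h i"
    define z where "z = (\<lambda>i. (g i - h i) div p i)"
    have "rat_of_int (g i) - rat_of_int (h i) = rat_of_int (p i) * rat_of_int (z i)" for i
    proof -
      have "g i - h i = p i * z i" using dvd by (simp add: z_def)
      then show ?thesis by (metis of_int_diff of_int_mult)
    qed
    then have "int_vec g - int_vec h = diag_mat (\<lambda>i. rat_of_int (p i)) *v int_vec z"
      by (simp add: vec_eq_iff diag_mat_mult_vec)
    then show "int_vec g - int_vec h \<in> ?H" by (auto simp: int_vectors_eq_range)
  qed
  have "bij_betw (\<lambda>g. (+) (int_vec g) ` ?H) ?R ((\<lambda>x. (+) x ` ?H) ` int_vectors)"
    unfolding bij_betw_def
  proof
    show "inj_on (\<lambda>g. (+) (int_vec g) ` ?H) ?R"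
    proof (rule inj_onI, rule ext)
      fix g h i
      assume gh: "g \<in> ?R" "h \<in> ?R" and "(+) (int_vec g) ` ?H = (+) (int_vec h) ` ?H"
      then have "\<bar>p i\<bar> dvd g i - h i"
        using mem by (simp add: coset_eq_iff[OF sub])
      then have "g i mod \<bar>p i\<bar> = h i mod \<bar>p i\<bar>" by (simp only: mod_eq_dvd_iff)
      moreover have "g i \<in> {0..<\<bar>p i\<bar>}" "h i \<in> {0..<\<bar>p i\<bar>}" using gh by (auto simp: PiE_iff)
      ultimately show "g i = h i" by simp
    qed
    show "(\<lambda>g. (+) (int_vec g) ` ?H) ` ?R = (\<lambda>x. (+) x ` ?H) ` int_vectors"
    proof (intro equalityI subsetI)
      fix C assume "C \<in> (\<lambda>x. (+) x ` ?H) ` int_vectors"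
      then obtain g where g: "C = (+) (int_vec g) ` ?H" by (auto simp: int_vectors_eq_range)
      define h where "h = (\<lambda>i. g i mod \<bar>p i\<bar>)"
      have "h \<in> ?R" using p by (auto simp: h_def)
      moreover have "p i dvd g i - h i" for i
      proof -
        have "\<bar>p i\<bar> dvd g i - g i mod \<bar>p i\<bar>" by (rule dvd_minus_mod)
        then show ?thesis by (metis abs_dvd_iff h_def)
      qed
      then have "C = (+) (int_vec h) ` ?H"
        unfolding g by (simp add: coset_eq_iff[OF sub] mem)
      ultimately show "C \<in> (\<lambda>g. (+) (int_vec g) ` ?H) ` ?R" by blast
    qed (auto simp: int_vectors_eq_range)
  qed
  then have "card ((\<lambda>x. (+) x ` ?H) ` int_vectors) = card ?R"
    by (metis bij_betw_same_card)
  then show ?thesis by (simp add: add_index_def card_PiE)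
qed

text \<open>
  The covolume as a relation, witnessed by some scaling factor. When a matrix with
  denominators is applied, the witness for the image is a multiple of the old one. Positivity of \<open>\<gamma>\<close> expresses that the index is finite.
\<close>

definition has_covol :: "(rat ^ 'n::finite) set \<Rightarrow> real \<Rightarrow> bool" where
  "has_covol L \<gamma> \<longleftrightarrow> add_subgroup L \<and> \<gamma> > 0 \<and>
     (\<exists>k>0. (*s) (of_nat k) ` L \<subseteq> int_vectors \<and>
        real (add_index int_vectors ((*s) (of_nat k) ` L)) = \<gamma> * real k ^ CARD('n))"

text \<open>
  If \<open>q\<close> is a common denominator of \<open>d\<close> and \<open>p = q d\<close>, then
  \<open>\<int>\<^sup>n \<supseteq> p \<int>\<^sup>n \<supseteq> p k L = (q k) (d L)\<close>. The first index is \<open>\<Prod>i. \<bar>p i\<bar>\<close>, and the second one equals the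
  index of \<open>k L\<close> in \<open>\<int>\<^sup>n\<close> because \<open>p\<close> acts injectively.
\<close>

lemma has_covol_diag_mat:
  fixes d :: "'n::finite \<Rightarrow> rat"
  assumes d: "\<And>i. d i \<noteq> 0" and L: "has_covol L \<gamma>"
  shows "has_covol ((*v) (diag_mat d) ` L) (real_of_rat \<bar>det (diag_mat d)\<bar> * \<gamma>)"
proof -
  obtain k where k: "k > 0" "(*s) (of_nat k) ` L \<subseteq> int_vectors"
      "real (add_index int_vectors ((*s) (of_nat k) ` L)) = \<gamma> * real k ^ CARD('n)"
    and sub: "add_subgroup L" and pos: "\<gamma> > 0"
    using L unfolding has_covol_def by blast
  obtain q :: nat where q: "q > 0" "\<And>i. of_nat q * d i \<in> \<int>"
    using common_denominator[of "range d"] by (metis finite rangeI finite_imageI)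
  then have "\<forall>i. \<exists>z. of_nat q * d i = rat_of_int z" by (auto simp: Ints_def)
  then obtain p where p: "\<And>i. of_nat q * d i = rat_of_int (p i)" by metis
  have p0: "p i \<noteq> 0" for i
    using p[of i] d[of i] q(1) by auto
  let ?p = "diag_mat (\<lambda>i. rat_of_int (p i))"
  let ?kL = "(*s) (of_nat k) ` L"
  have kL: "add_subgroup ?kL"
    unfolding scale_eq_diag_mat by (intro add_subgroup_image additive_matrix sub)
  have img: "(*s) (of_nat (q * k)) ` (*v) (diag_mat d) ` L = (*v) ?p ` ?kL"
    unfolding image_image
    by (intro image_cong refl) (simp add: vec_eq_iff diag_mat_mult_vec p[symmetric])
  have pint: "(*v) ?p ` int_vectors \<subseteq> int_vectors"
    by (auto simp: int_vectors_def diag_mat_mult_vec)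
  have "add_index int_vectors ((*v) ?p ` ?kL)
      = add_index int_vectors ((*v) ?p ` int_vectors) * add_index ((*v) ?p ` int_vectors) ((*v) ?p ` ?kL)"
    using pint k(2)
    by (intro add_index_mult add_subgroup_image additive_matrix add_subgroup_int_vectors kL image_mono)
  also have "\<dots> = (\<Prod>i\<in>UNIV. nat \<bar>p i\<bar>) * add_index int_vectors ?kL"
    using p0 by (simp add: add_index_diag_mat add_index_image additive_matrix inj_diag_mat)
  finally have idx: "real (add_index int_vectors ((*v) ?p ` ?kL))
      = (\<Prod>i\<in>UNIV. real (nat \<bar>p i\<bar>)) * (\<gamma> * real k ^ CARD('n))"
    by (simp add: k(3))
  have "real (nat \<bar>p i\<bar>) = real q * real_of_rat \<bar>d i\<bar>" for i
  proof -
    have "rat_of_int \<bar>p i\<bar> = of_nat q * \<bar>d i\<bar>"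
      by (simp add: p[symmetric] abs_mult)
    then have "real_of_rat (rat_of_int \<bar>p i\<bar>) = real_of_rat (of_nat q * \<bar>d i\<bar>)" by simp
    moreover have "real (nat \<bar>p i\<bar>) = real_of_rat (rat_of_int \<bar>p i\<bar>)"
      by (simp only: of_rat_of_int_eq)
    ultimately show ?thesis by (simp add: of_rat_mult)
  qed
  then have "(\<Prod>i\<in>UNIV. real (nat \<bar>p i\<bar>)) = real q ^ CARD('n) * real_of_rat \<bar>det (diag_mat d)\<bar>"
    by (simp add: det_diag_mat prod.distrib abs_prod of_rat_prod)
  then have "real (add_index int_vectors ((*v) ?p ` ?kL))
      = real_of_rat \<bar>det (diag_mat d)\<bar> * \<gamma> * real (q * k) ^ CARD('n)"
    by (simp add: idx power_mult_distrib)
  moreover have "(*v) ?p ` ?kL \<subseteq> int_vectors"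
    using pint k(2) by blast
  ultimately have "\<exists>m>0. (*s) (of_nat m) ` (*v) (diag_mat d) ` L \<subseteq> int_vectors \<and>
      real (add_index int_vectors ((*s) (of_nat m) ` (*v) (diag_mat d) ` L))
        = real_of_rat \<bar>det (diag_mat d)\<bar> * \<gamma> * real m ^ CARD('n)"
    using q(1) k(1) by (intro exI[of _ "q * k"] conjI) (simp_all only: img, simp)
  moreover have "det (diag_mat d) \<noteq> 0"
    using d by (simp add: det_diag_mat)
  then have "real_of_rat \<bar>det (diag_mat d)\<bar> * \<gamma> > 0"
    using pos by simp
  moreover have "add_subgroup ((*v) (diag_mat d) ` L)"
    by (intro add_subgroup_image additive_matrix sub)
  ultimately show ?thesis unfolding has_covol_def by blast
qed

lemma has_covol_unimodular:
  fixes A :: "rat ^ 'n::finite ^ 'n"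
  assumes A: "(*v) A ` int_vectors = int_vectors" "inj ((*v) A)" and L: "has_covol L \<gamma>"
  shows "has_covol ((*v) A ` L) \<gamma>"
proof -
  have comm: "(*s) (of_nat k) ` (*v) A ` L = (*v) A ` (*s) (of_nat k) ` L" for k
    by (simp add: image_image vector_scalar_commute)
  have "add_index int_vectors ((*v) A ` X) = add_index int_vectors X" for X
    using add_index_image[OF additive_matrix A(2), of int_vectors X] A(1) by simp
  moreover have "(*v) A ` X \<subseteq> int_vectors" if "X \<subseteq> int_vectors" for X
    using A(1) that by blast
  ultimately show ?thesis
    using L unfolding has_covol_def comm by (metis add_subgroup_image additive_matrix)
qed

text \<open>
  The inverse shear is integral as well, so both preserve \<open>\<int>\<^sup>n\<close>.
\<close>

lemma has_covol_shear:
  fixes c :: "rat ^ 'n::finite"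
  assumes c: "c \<in> int_vectors" "c $ s = 1" and L: "has_covol L \<gamma>"
  shows "has_covol ((*v) (col_mat s c) ` L) \<gamma>"
proof (rule has_covol_unimodular[OF _ _ L])
  define c' where "c' = (\<chi> i. if i = s then 1 else - c $ i)"
  have inv: "col_mat s c *v (col_mat s c' *v x) = x" "col_mat s c' *v (col_mat s c *v x) = x" for x
    using c(2) by (simp_all add: vec_eq_iff col_mat_mult_vec c'_def)
  show "inj ((*v) (col_mat s c))"
    by (metis inv(2) injI)
  have int: "col_mat s b *v x \<in> int_vectors" if "b \<in> int_vectors" "x \<in> int_vectors" for b x
    using that by (auto simp: int_vectors_def col_mat_mult_vec intro!: Ints_add Ints_mult)
  have "c' \<in> int_vectors" using c by (auto simp: int_vectors_def c'_def)
  then show "(*v) (col_mat s c) ` int_vectors = int_vectors"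
    using int c(1) inv(1) by (metis (no_types, lifting) image_subsetI subset_antisym subsetI image_eqI)
qed

text \<open>
  By \<open>nonsingular_induct\<close> only \<open>col_mat s c\<close> remains. It becomes an integral shear once the coordinate
  \<open>s\<close> has been divided by a common denominator \<open>q\<close> of \<open>c\<close>; a second diagonal matrix restores the
  entry \<open>c\<^sub>s\<close>.
\<close>

lemma has_covol_matrix:
  fixes A :: "rat ^ 'n::finite ^ 'n"
  assumes "det A \<noteq> 0" and "has_covol L \<gamma>"
  shows "has_covol ((*v) A ` L) (real_of_rat \<bar>det A\<bar> * \<gamma>)"
proof -
  define P where "P = (\<lambda>A :: rat ^ 'n ^ 'n. \<forall>L \<gamma>. has_covol L \<gamma>
      \<longrightarrow> has_covol ((*v) A ` L) (real_of_rat \<bar>det A\<bar> * \<gamma>))"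
  have mult: "P (A ** B)" if "P A" "P B" for A B
  proof -
    have "(*v) (A ** B) ` L = (*v) A ` (*v) B ` L" for L
      by (simp add: image_image matrix_vector_mul_assoc)
    then show ?thesis
      using that unfolding P_def by (auto simp: det_mul abs_mult of_rat_mult mult.assoc)
  qed
  have diag: "P (diag_mat d)" if "\<And>i. d i \<noteq> 0" for d
    unfolding P_def by (intro allI impI has_covol_diag_mat that)
  have "P A"
  proof (rule nonsingular_induct[where P = P])
    show "P (mat 1)" by (simp add: P_def)
    fix s and c :: "rat ^ 'n" assume cs: "c $ s \<noteq> 0"
    obtain q :: nat where q: "q > 0" "\<And>i. of_nat q * c $ i \<in> \<int>"
      using common_denominator[of "range (($) c)"] by (metis finite rangeI finite_imageI)
    define b where "b = (\<chi> i. if i = s then 1 else of_nat q * c $ i)"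
    have "P (col_mat s b)"
      using has_covol_shear[of b s] q(2)
      unfolding P_def by (auto simp: det_col_mat b_def int_vectors_def)
    moreover have "P (diag_mat (\<lambda>i. if i = s then of_nat q * c $ s else 1))"
      using cs q(1) by (intro diag) auto
    moreover have "P (diag_mat (\<lambda>i. if i = s then 1 / of_nat q else 1))"
      using q(1) by (intro diag) auto
    moreover have "col_mat s c = diag_mat (\<lambda>i. if i = s then of_nat q * c $ s else 1) **
        (col_mat s b ** diag_mat (\<lambda>i. if i = s then 1 / of_nat q else 1))"
      using q(1)
      by (intro iffD2[OF matrix_eq])
         (simp add: vec_eq_iff matrix_vector_mul_assoc[symmetric] col_mat_mult_vec
           diag_mat_mult_vec b_def)
    ultimately show "P (col_mat s c)" using mult by metis
  qed (use mult assms in auto)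
  then show ?thesis using assms unfolding P_def by blast
qed

section \<open>Lattices have a covolume\<close>

lemma rat_lattice_clears_denominators:
  assumes "rat_lattice \<Lambda>"
  shows "\<exists>a. clears_denominators a \<Lambda>"
proof -
  obtain B where B: "finite B" "\<Lambda> = group_closure B"
    using assms by (auto simp: rat_lattice_def)
  have "finite ((\<lambda>(x, i). x $ i) ` (B \<times> UNIV))" using B by simp
  then obtain q :: nat where q: "q > 0"
      "\<And>y. y \<in> (\<lambda>(x, i). x $ i) ` (B \<times> UNIV) \<Longrightarrow> of_nat q * y \<in> \<int>"
    using common_denominator by blast
  have "of_nat q *s x \<in> int_vectors" if "x \<in> group_closure B" for x
    using that
  proof induction
    case (base x)
    then show ?case using q(2) by (force simp: int_vectors_def)
  next
    case (diff x y)
    then show ?case by (simp add: int_vectors_def right_diff_distrib)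
  qed
  then show ?thesis using q(1) B by (auto simp: clears_denominators_def)
qed

lemma add_subgroup_scale_int:
  fixes H :: "(rat ^ 'n::finite) set"
  assumes "add_subgroup H" "x \<in> H"
  shows "of_int z *s x \<in> H"
proof -
  have nat: "of_nat m *s y \<in> H" if "y \<in> H" for m y
  proof (induction m)
    case (Suc m)
    then show ?case using add_subgroup_add[OF assms(1) that] by (simp add: vec.scale_left_distrib)
  qed (use add_subgroup_zero[OF assms(1)] in simp)
  show ?thesis
  proof (cases z)
    case (nonneg m)
    then show ?thesis using nat[OF assms(2)] by simp
  next
    case (neg m)
    have "0 - of_nat (Suc m) *s x \<in> H"
      by (intro add_subgroup_diff add_subgroup_zero nat assms)
    then show ?thesis using neg by (simp del: of_nat_Suc)
  qed
qed

text \<open>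
  The vectors with a positive integral multiple in \<open>H\<close> form a rational subspace containing \<open>H\<close>.
\<close>

lemma spanning_subgroup_contains_multiple:
  fixes H :: "(rat ^ 'n::finite) set"
  assumes H: "add_subgroup H" and span: "vec.span H = UNIV"
  shows "\<exists>m>0. of_nat m *s x \<in> H"
proof -
  have mult: "of_nat (m * k) *s y \<in> H" if "of_nat m *s y \<in> H" for m k y
    using add_subgroup_scale_int[OF H that, of "int k"] by (simp add: mult.commute)
  let ?V = "{x. \<exists>m>0. of_nat m *s x \<in> H}"
  have "vec.subspace ?V"
  proof (rule vec.subspaceI)
    show "0 \<in> ?V" using add_subgroup_zero[OF H] by auto
  next
    fix x y assume "x \<in> ?V" "y \<in> ?V"
    then obtain m k where mk: "m > 0" "k > 0" "of_nat m *s x \<in> H" "of_nat k *s y \<in> H" by auto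
    have "of_nat (m * k) *s x + of_nat (m * k) *s y \<in> H"
      using mult[OF mk(3), of k] mult[OF mk(4), of m]
      by (intro add_subgroup_add[OF H]) (simp_all add: mult.commute)
    then show "x + y \<in> ?V"
      using mk by (intro CollectI exI[of _ "m * k"]) (simp add: vec.scale_right_distrib)
  next
    fix c :: rat and x assume "x \<in> ?V"
    then obtain m where m: "m > 0" "of_nat m *s x \<in> H" by auto
    obtain a b where ab: "c = of_int a / of_int b" "b > 0"
      by (metis Fract_of_int_quotient Rat_cases)
    have "of_nat (m * nat b) * c = of_int a * of_nat m"
      using ab by simp
    then have "of_nat (m * nat b) *s (c *s x) = of_int a *s (of_nat m *s x)"
      by (simp only: vec.scale_scale)
    then show "c *s x \<in> ?V"
      using add_subgroup_scale_int[OF H m(2), of a] m(1) ab(2)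
      by (intro CollectI exI[of _ "m * nat b"] conjI) (simp, simp only:)
  qed
  moreover have "H \<subseteq> ?V"
    by (intro subsetI CollectI exI[of _ 1]) simp
  ultimately have "vec.span H \<subseteq> ?V" by (rule vec.span_minimal[rotated])
  then show ?thesis using span by auto
qed

lemma spanning_subgroup_contains_scaled_int_vectors:
  fixes H :: "(rat ^ 'n::finite) set"
  assumes H: "add_subgroup H" and span: "vec.span H = UNIV"
  shows "\<exists>m>0. (*s) (of_nat m) ` int_vectors \<subseteq> H"
proof -
  obtain m where m: "\<And>i. m i > 0" "\<And>i. of_nat (m i) *s axis i 1 \<in> H"
  proof -
    have "\<forall>i. \<exists>m>0. of_nat m *s axis i 1 \<in> H"
      using spanning_subgroup_contains_multiple[OF H span] by blast
    then show thesis using that by metis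
  qed
  define M where "M = (\<Prod>i\<in>UNIV. m i)"
  have "of_nat M *s axis i 1 \<in> H" for i
  proof -
    have "m i dvd M" unfolding M_def by (intro dvd_prodI) auto
    then obtain r where r: "M = m i * r" by blast
    show ?thesis using add_subgroup_scale_int[OF H m(2)[of i], of "int r"]
      by (simp add: r mult.commute)
  qed
  then have ax: "of_int z *s (of_nat M *s axis i 1) \<in> H" for z i
    by (intro add_subgroup_scale_int H)
  have sum: "sum f S \<in> H" if "\<And>i. f i \<in> H" for f :: "'n \<Rightarrow> _" and S
    by (induction S rule: infinite_finite_induct)
       (auto intro: add_subgroup_zero[OF H] add_subgroup_add[OF H] that)
  have "of_nat M *s int_vec g \<in> H" for g
  proof -
    have "of_nat M *s int_vec g = (\<Sum>i\<in>UNIV. of_int (g i) *s (of_nat M *s axis i 1))"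
      by (simp add: vec_eq_iff axis_def if_distrib[of "\<lambda>z. _ * z"] cong: if_cong)
    also have "\<dots> \<in> H" by (intro sum ax)
    finally show ?thesis .
  qed
  moreover have "M > 0" using m(1) by (simp add: M_def prod_pos)
  ultimately show ?thesis by (auto simp: int_vectors_eq_range)
qed

text \<open>
  The index that defines the covolume is finite because \<open>a \<Lambda>\<close> lies between \<open>\<int>\<^sup>n\<close> and some
  \<open>a m \<int>\<^sup>n\<close>, whose index is \<open>(a m)\<^sup>n\<close>.
\<close>

lemma has_covol_covol:
  fixes \<Lambda> :: "(rat ^ 'n::finite) set"
  assumes "rat_lattice \<Lambda>"
  shows "has_covol \<Lambda> (covol \<Lambda>)"
proof -
  define a where "a = (SOME a. clears_denominators a \<Lambda>)"
  have a: "a > 0" "(*s) (of_nat a) ` \<Lambda> \<subseteq> int_vectors"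
    using someI_ex[OF rat_lattice_clears_denominators[OF assms]]
    by (simp_all add: a_def clears_denominators_def)
  have sub: "add_subgroup \<Lambda>" and span: "vec.span \<Lambda> = UNIV"
    using assms add_subgroup_group_closure by (auto simp: rat_lattice_def)
  obtain m where m: "m > 0" "(*s) (of_nat m) ` int_vectors \<subseteq> \<Lambda>"
    using spanning_subgroup_contains_scaled_int_vectors[OF sub span] by blast
  let ?aL = "(*s) (of_nat a) ` \<Lambda>"
  let ?D = "(*v) (diag_mat (\<lambda>_ :: 'n. rat_of_int (int (a * m))))"
  have aL: "add_subgroup ?aL"
    unfolding scale_eq_diag_mat by (intro add_subgroup_image additive_matrix sub)
  have "?D ` int_vectors = (*s) (of_nat a) ` (*s) (of_nat m) ` int_vectors"
    unfolding image_image
    by (intro image_cong refl) (simp add: vec_eq_iff diag_mat_mult_vec)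
  then have "?D ` int_vectors \<subseteq> ?aL" using m by blast
  then have "add_index int_vectors (?D ` int_vectors)
      = add_index int_vectors ?aL * add_index ?aL (?D ` int_vectors)"
    by (rule add_index_mult[OF add_subgroup_int_vectors aL
        add_subgroup_image[OF additive_matrix add_subgroup_int_vectors] a(2)])
  moreover have "add_index int_vectors (?D ` int_vectors) > 0"
    using a m by (subst add_index_diag_mat) auto
  ultimately have "add_index int_vectors ?aL > 0" by (metis gr0I mult_0 less_irrefl)
  moreover have cov: "covol \<Lambda> = real (add_index int_vectors ?aL) / real a ^ CARD('n)"
    by (simp add: covol_def a_def Let_def)
  ultimately show ?thesis
    unfolding has_covol_def using sub a by (auto intro!: exI[of _ a])
qed

section \<open>Linear forms\<close>

text \<open>
  The box of integral points \<open>0 \<le> y\<^sub>i \<le> \<lfloor>\<delta>\<^sub>i\<rfloor>\<close> has more elements than there are cosets of \<open>H\<close>. Since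
  \<open>\<lfloor>\<delta>\<^sub>i\<rfloor> + 1 > \<delta>\<^sub>i\<close> is strict, the index may be as large as \<open>\<Prod>i. \<delta>\<^sub>i\<close> itself.
\<close>

lemma subgroup_point_in_box:
  fixes H :: "(rat ^ 'n::finite) set" and \<delta> :: "'n \<Rightarrow> real"
  assumes H: "add_subgroup H" and idx: "add_index int_vectors H > 0"
    and pos: "\<And>i. \<delta> i > 0" and le: "real (add_index int_vectors H) \<le> (\<Prod>i\<in>UNIV. \<delta> i)"
  shows "\<exists>y\<in>H. y \<noteq> 0 \<and> (\<forall>i. real_of_rat \<bar>y $ i\<bar> \<le> \<delta> i)"
proof -
  let ?R = "PiE UNIV (\<lambda>i. {0..\<lfloor>\<delta> i\<rfloor>})"
  let ?Q = "(\<lambda>x. (+) x ` H) ` int_vectors"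
  have fin: "finite ?Q"
    using idx unfolding add_index_def by (rule card_ge_0_finite)
  have "(\<Prod>i\<in>UNIV. \<delta> i) < (\<Prod>i\<in>UNIV. real (nat (\<lfloor>\<delta> i\<rfloor> + 1)))"
  proof (rule prod_mono_strict)
    have lt: "\<delta> i < real (nat (\<lfloor>\<delta> i\<rfloor> + 1))" for i
      using pos[of i] by (simp add: less_imp_le)
    show "\<delta> undefined < real (nat (\<lfloor>\<delta> undefined\<rfloor> + 1))" by (rule lt)
    show "0 \<le> \<delta> i \<and> \<delta> i \<le> real (nat (\<lfloor>\<delta> i\<rfloor> + 1))" for i
      using pos[of i] lt[of i] by simp
    show "0 < real (nat (\<lfloor>\<delta> i\<rfloor> + 1))" for i
      using pos[of i] lt[of i] by linarith
  qed auto
  then have "card ?Q < card ?R"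
    using le unfolding add_index_def by (simp add: card_PiE flip: of_nat_prod)
  moreover have "(\<lambda>g. (+) (int_vec g) ` H) ` ?R \<subseteq> ?Q"
    by (auto simp: int_vectors_eq_range)
  then have "card ((\<lambda>g. (+) (int_vec g) ` H) ` ?R) \<le> card ?Q"
    using fin by (rule card_mono[rotated])
  ultimately have "\<not> inj_on (\<lambda>g. (+) (int_vec g) ` H) ?R"
    by (intro pigeonhole) simp
  then obtain g h where gh: "g \<in> ?R" "h \<in> ?R" "g \<noteq> h"
      "(+) (int_vec g) ` H = (+) (int_vec h) ` H"
    by (auto simp: inj_on_def)
  let ?y = "int_vec g - int_vec h"
  have "?y \<in> H" using gh(4) coset_eq_iff[OF H] by blast
  moreover have "?y \<noteq> 0"
  proof
    assume "?y = 0"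
    then have "int_vec g $ i = int_vec h $ i" for i by simp
    then show False using gh(3) by auto
  qed
  moreover have "real_of_rat \<bar>?y $ i\<bar> \<le> \<delta> i" for i
  proof -
    have "g i \<in> {0..\<lfloor>\<delta> i\<rfloor>}" "h i \<in> {0..\<lfloor>\<delta> i\<rfloor>}" using gh by (auto simp: PiE_iff)
    then have "\<bar>g i - h i\<bar> \<le> \<lfloor>\<delta> i\<rfloor>" by auto
    then have "real_of_int \<bar>g i - h i\<bar> \<le> \<delta> i" by linarith
    moreover have "real_of_rat \<bar>?y $ i\<bar> = real_of_int \<bar>g i - h i\<bar>"
    proof -
      have "\<bar>?y $ i\<bar> = rat_of_int \<bar>g i - h i\<bar>" by simp
      then show ?thesis by (metis of_rat_of_int_eq)
    qed
    ultimately show ?thesis by simp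
  qed
  ultimately show ?thesis by blast
qed

lemma linear_admissible_one: "linear_admissible TYPE('n::finite) 1"
  unfolding linear_admissible_def
proof (intro allI impI)
  fix M :: "rat ^ 'n ^ 'n" and \<Lambda> :: "(rat ^ 'n) set" and \<epsilon> :: "'n \<Rightarrow> real"
  assume M: "invertible M" and \<Lambda>: "rat_lattice \<Lambda>" and pos: "\<forall>i. \<epsilon> i > 0"
    and le: "real_of_rat \<bar>det M\<bar> * covol \<Lambda> \<le> 1 * (\<Prod>i\<in>UNIV. \<epsilon> i)"
  have "det M \<noteq> 0" using M by (simp add: invertible_det_nz)
  then have "has_covol ((*v) M ` \<Lambda>) (real_of_rat \<bar>det M\<bar> * covol \<Lambda>)"
    by (rule has_covol_matrix[OF _ has_covol_covol[OF \<Lambda>]])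
  then obtain k where sub: "add_subgroup ((*v) M ` \<Lambda>)"
    and cov: "real_of_rat \<bar>det M\<bar> * covol \<Lambda> > 0" and k: "k > 0"
    and idx: "real (add_index int_vectors ((*s) (of_nat k) ` (*v) M ` \<Lambda>))
        = real_of_rat \<bar>det M\<bar> * covol \<Lambda> * real k ^ CARD('n)"
    unfolding has_covol_def by blast
  let ?H = "(*s) (of_nat k) ` (*v) M ` \<Lambda>"
  have "\<exists>y\<in>?H. y \<noteq> 0 \<and> (\<forall>i. real_of_rat \<bar>y $ i\<bar> \<le> real k * \<epsilon> i)"
  proof (rule subgroup_point_in_box)
    show "add_subgroup ?H"
      unfolding scale_eq_diag_mat by (intro add_subgroup_image additive_matrix sub)
    have "real (add_index int_vectors ?H) > 0" using idx cov k by simp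
    then show "add_index int_vectors ?H > 0" by simp
    show "real (add_index int_vectors ?H) \<le> (\<Prod>i\<in>UNIV. real k * \<epsilon> i)"
      using le k by (simp add: idx prod.distrib mult.commute mult_left_mono)
  qed (use pos k in auto)
  then obtain x where x: "x \<in> \<Lambda>" "of_nat k *s (M *v x) \<noteq> 0"
      "\<And>i. real_of_rat \<bar>of_nat k * (M *v x) $ i\<bar> \<le> real k * \<epsilon> i"
    by auto
  have "x \<noteq> 0" using x(2) by auto
  moreover have "real_of_rat \<bar>\<Sum>j\<in>UNIV. M $ i $ j * x $ j\<bar> \<le> \<epsilon> i" for i
  proof -
    have "real k * real_of_rat \<bar>(M *v x) $ i\<bar> \<le> real k * \<epsilon> i"
      using x(3)[of i] by (simp add: abs_mult of_rat_mult)
    then show ?thesis using k by (simp add: matrix_vector_mult_def)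
  qed
  ultimately show "\<exists>x\<in>\<Lambda>. x \<noteq> 0 \<and> (\<forall>i. real_of_rat \<bar>\<Sum>j\<in>UNIV. M $ i $ j * x $ j\<bar> \<le> \<epsilon> i)"
    using x(1) by blast
qed

lemma rat_lattice_int_vectors: "rat_lattice (int_vectors :: (rat ^ 'n::finite) set)"
proof -
  let ?B = "cart_basis :: (rat ^ 'n) set"
  let ?G = "group_closure ?B"
  have ax: "axis i 1 \<in> ?G" for i
    by (rule group_closure.base) (auto simp: cart_basis_def)
  have sum: "sum f S \<in> ?G" if "\<And>i. f i \<in> ?G" for f :: "'n \<Rightarrow> _" and S
    by (induction S rule: infinite_finite_induct) (auto intro: group_closure_add that)
  have "int_vec g \<in> ?G" for g
  proof -
    have "int_vec g = (\<Sum>i\<in>UNIV. of_int (g i) *s axis i 1)"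
      by (simp add: vec_eq_iff axis_def if_distrib[of "\<lambda>z. _ * z"] cong: if_cong)
    also have "\<dots> \<in> ?G"
      by (intro sum add_subgroup_scale_int add_subgroup_group_closure ax)
    finally show ?thesis .
  qed
  moreover have "x \<in> int_vectors" if "x \<in> ?G" for x
    using that by induction (auto simp: int_vectors_def cart_basis_def axis_def)
  ultimately have eq: "int_vectors = ?G" by (auto simp: int_vectors_eq_range)
  moreover have "vec.span ?G = UNIV"
    using vec.span_mono[of ?B ?G] by (auto intro: group_closure.base)
  ultimately show ?thesis
    unfolding rat_lattice_def by (metis finite_cart_basis)
qed

lemma covol_int_vectors: "covol (int_vectors :: (rat ^ 'n::finite) set) = 1"
proof -
  define a where "a = (SOME a. clears_denominators a (int_vectors :: (rat ^ 'n) set))"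
  have a: "a > 0"
    using someI_ex[OF rat_lattice_clears_denominators[OF rat_lattice_int_vectors, where 'a = 'n]]
    by (simp add: a_def clears_denominators_def)
  have "(\<lambda>x. of_nat a *s x) ` (int_vectors :: (rat ^ 'n) set)
      = (*v) (diag_mat (\<lambda>_. rat_of_int (int a))) ` int_vectors"
    by (simp add: scale_eq_diag_mat)
  then have "add_index int_vectors ((\<lambda>x. of_nat a *s x) ` (int_vectors :: (rat ^ 'n) set)) = a ^ CARD('n)"
    using a by (simp only: add_index_diag_mat) simp
  then show ?thesis using a by (simp add: covol_def a_def[symmetric] Let_def)
qed

lemma linear_admissible_le_one:
  assumes "linear_admissible TYPE('n::finite) C"
  shows "C \<le> 1"
proof (rule ccontr)
  assume "\<not> C \<le> 1"
  then have C: "C > 1" by simp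
  define e where "e = root CARD('n) (1 / C)"
  have e: "e > 0" "e < 1" "e ^ CARD('n) = 1 / C"
    using C by (auto simp: e_def)
  have "\<exists>x\<in>int_vectors. x \<noteq> 0 \<and>
      (\<forall>i. real_of_rat \<bar>\<Sum>j\<in>UNIV. (mat 1 :: rat ^ 'n ^ 'n) $ i $ j * x $ j\<bar> \<le> e)"
  proof (rule assms[unfolded linear_admissible_def, rule_format])
    show "invertible (mat 1 :: rat ^ 'n ^ 'n)" by (simp add: invertible_det_nz)
    show "real_of_rat \<bar>det (mat 1 :: rat ^ 'n ^ 'n)\<bar> * covol (int_vectors :: (rat ^ 'n) set)
        \<le> C * (\<Prod>i\<in>(UNIV :: 'n set). e)"
      using C e(3) by (simp add: covol_int_vectors)
  qed (use e(1) rat_lattice_int_vectors in auto)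
  then obtain g where g: "int_vec g \<noteq> 0"
      and le: "\<And>i. real_of_rat \<bar>((mat 1 :: rat ^ 'n ^ 'n) *v int_vec g) $ i\<bar> \<le> e"
    unfolding int_vectors_eq_range matrix_vector_mult_def vec_lambda_beta by blast
  have "g i = 0" for i
  proof -
    have "\<bar>((mat 1 :: rat ^ 'n ^ 'n) *v int_vec g) $ i\<bar> = rat_of_int \<bar>g i\<bar>" by simp
    then have "real_of_int \<bar>g i\<bar> \<le> e" using le[of i] by (metis of_rat_of_int_eq)
    then show ?thesis using e(2) by linarith
  qed
  then show False using g by (simp add: vec_eq_iff)
qed

theorem theorem3p2:
  shows "linear_constant TYPE('n::finite) = 1"
  unfolding linear_constant_def
proof (rule antisym)
  show "Sup (ereal ` {C. C > 0 \<and> linear_admissible TYPE('n) C}) \<le> 1"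
    using linear_admissible_le_one by (auto intro!: Sup_least)
  have "ereal 1 \<le> Sup (ereal ` {C. C > 0 \<and> linear_admissible TYPE('n) C})"
    by (intro Sup_upper imageI CollectI conjI linear_admissible_one) simp
  then show "1 \<le> Sup (ereal ` {C. C > 0 \<and> linear_admissible TYPE('n) C})"
    by (simp add: one_ereal_def)
qed

end
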